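(* For every non-trivial Boolean algebra $B$, the poset $\mathrm{UC}(B)$ of all ultracontacts on $B$ ordered by inclusion is a complete lattice, in which joins are given by set-theoretical unions.
   Context: Let $B$ be a non-trivial Boolean algebra with order $\le$ and join $+$. For $F,G\subseteq B$ put $F+G=\{f+g: f\in F,\ g\in G\}$, and write $F\preceq G$ iff for every $g\in G$ there is $f\in F$ with $f\le g$. An ultracontact on $B$ is a family $\mathscr K\subseteq 2^B$ such that for all $F,G\subseteq B$: (K0) $\emptyset\notin\mathscr K$; (K1) if $0\in F$ then $F\notin\mathscr K$; (K2) if $x\neq 0$ then $\{x\}\in\mathscr K$; (K3) if $F\preceq G$, $G\neq\emptyset$ and $F\in\mathscr K$, then $G\in\mathscr K$; (K4) if $F+G\in\mathscr K$ then $F\in\mathscr K$ or $G\in\mathscr K$.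
   Formalization: Joins are stated to be unions only for non-empty families of ultracontacts: the union of the empty family is empty, which is not an ultracontact on a non-trivial algebra by (K2); the empty join still exists as the least ultracontact. *)

theory Defs
  imports "HOL-Algebra.Complete_Lattice"
begin

text \<open>
  The Boolean algebra is an arbitrary type of class \<open>boolean_algebra\<close>. Its operations are written
  with qualified names because HOL-Algebra reuses \<open>sup\<close> and \<open>top\<close> for its record-based orders.
\<close>

definition set_join :: "'a::boolean_algebra set \<Rightarrow> 'a set \<Rightarrow> 'a set" (infixl "\<oplus>\<^sub>s" 65)
  where "F \<oplus>\<^sub>s G = {sup_class.sup f g | f g. f \<in> F \<and> g \<in> G}"

definition set_prec :: "'a::boolean_algebra set \<Rightarrow> 'a set \<Rightarrow> bool" (infix "\<preceq>\<^sub>s" 50)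
  where "F \<preceq>\<^sub>s G \<longleftrightarrow> (\<forall>g\<in>G. \<exists>f\<in>F. f \<le> g)"

locale ultracontact =
  fixes K :: "'a::boolean_algebra set set"
  assumes K0: "{} \<notin> K"
    and K1: "bot_class.bot \<in> F \<Longrightarrow> F \<notin> K"
    and K2: "x \<noteq> bot_class.bot \<Longrightarrow> {x} \<in> K"
    and K3: "F \<preceq>\<^sub>s G \<Longrightarrow> G \<noteq> {} \<Longrightarrow> F \<in> K \<Longrightarrow> G \<in> K"
    and K4: "F \<oplus>\<^sub>s G \<in> K \<Longrightarrow> F \<in> K \<or> G \<in> K"

definition UC :: "'a::boolean_algebra set set gorder"
  where "UC = \<lparr>carrier = {K. ultracontact K}, eq = (=), le = (\<subseteq>)\<rparr>"

text \<open>
  Over a non-trivial algebra the empty union is not an ultracontact, so the description of joins as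
  unions can only concern non-empty families; the join of the empty family is the least ultracontact.
\<close>

lemma empty_not_ultracontact:
  assumes "(bot_class.bot :: 'a::boolean_algebra) \<noteq> top_class.top"
  shows "\<not> ultracontact ({} :: 'a set set)"
  using assms ultracontact.K2[of "{}" "top_class.top :: 'a"] by auto

end

theory Submission
  imports Defs
begin

text \<open>
  The union of a non-empty family of ultracontacts is an ultracontact, and the non-empty sets with a
  non-zero lower bound form the least one. So suprema exist, and an infimum is the supremum of the
  lower bounds. The only axiom that is not immediate for the least ultracontact is K4: if
  \<open>x \<le> f + g\<close> for all \<open>f \<in> F\<close>, \<open>g \<in> G\<close>, then \<open>x - f\<close> is a lower bound of \<open>G\<close> for each \<open>f \<in> F\<close>;
  either some \<open>x - f\<close> is non-zero, or \<open>x\<close> is a lower bound of \<open>F\<close>.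
\<close>

text \<open>K3 and K4 have a single membership premise each, so they can be applied inside one
  member of the family. For intersections this breaks at K4, where different members may choose
  different disjuncts.\<close>

lemma ultracontact_Union:
  fixes \<A> :: "'a::boolean_algebra set set set"
  assumes "\<And>K. K \<in> \<A> \<Longrightarrow> ultracontact K" and "\<A> \<noteq> {}"
  shows "ultracontact (\<Union>\<A>)"
proof
  show "{} \<notin> \<Union>\<A>"
    using assms(1) ultracontact.K0 by blast
next
  fix F :: "'a set" assume "bot_class.bot \<in> F"
  then show "F \<notin> \<Union>\<A>"
    using assms(1) ultracontact.K1 by blast
next
  fix x :: 'a assume "x \<noteq> bot_class.bot"
  then show "{x} \<in> \<Union>\<A>"
    using assms ultracontact.K2 by blast
next
  fix F G :: "'a set" assume "F \<preceq>\<^sub>s G" "G \<noteq> {}" "F \<in> \<Union>\<A>"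
  then show "G \<in> \<Union>\<A>"
    using assms(1) ultracontact.K3 by blast
next
  fix F G :: "'a set" assume "F \<oplus>\<^sub>s G \<in> \<Union>\<A>"
  then show "F \<in> \<Union>\<A> \<or> G \<in> \<Union>\<A>"
    using assms(1) ultracontact.K4 by blast
qed

definition least_ultracontact :: "'a::boolean_algebra set set"
  where "least_ultracontact = {F. F \<noteq> {} \<and> (\<exists>x. x \<noteq> bot_class.bot \<and> (\<forall>f\<in>F. x \<le> f))}"

lemma ultracontact_least_ultracontact:
  "ultracontact (least_ultracontact :: 'a::boolean_algebra set set)"
proof
  show "({} :: 'a set) \<notin> least_ultracontact"
    by (simp add: least_ultracontact_def)
next
  fix F :: "'a set" assume "bot_class.bot \<in> F"
  then show "F \<notin> least_ultracontact"
    unfolding least_ultracontact_def using bot_unique by blast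
next
  fix x :: 'a assume "x \<noteq> bot_class.bot"
  then show "{x} \<in> least_ultracontact"
    by (auto simp: least_ultracontact_def)
next
  fix F G :: "'a set" assume "F \<preceq>\<^sub>s G" "G \<noteq> {}" "F \<in> least_ultracontact"
  then show "G \<in> least_ultracontact"
    unfolding least_ultracontact_def set_prec_def by (blast intro: order_trans)
next
  fix F G :: "'a set" assume FG: "F \<oplus>\<^sub>s G \<in> least_ultracontact"
  then have ne: "F \<noteq> {}" "G \<noteq> {}"
    by (auto simp: least_ultracontact_def set_join_def)
  obtain x where x: "x \<noteq> bot_class.bot"
    and le: "\<And>f g. f \<in> F \<Longrightarrow> g \<in> G \<Longrightarrow> x \<le> sup_class.sup f g"
    using FG unfolding least_ultracontact_def set_join_def by blast
  show "F \<in> least_ultracontact \<or> G \<in> least_ultracontact"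
  proof (cases "\<forall>f\<in>F. x \<le> f")
    case True
    then show ?thesis using x ne by (auto simp: least_ultracontact_def)
  next
    case False
    then obtain f where f: "f \<in> F" "\<not> x \<le> f" by blast
    \<comment> \<open>This meet is the difference \<open>x - f\<close>, which vanishes exactly when
      \<open>x \<le> f\<close>.\<close>
    have "inf_class.inf x (- f) \<noteq> bot_class.bot"
      using f(2) by (metis double_compl inf_shunt)
    moreover have "inf_class.inf x (- f) \<le> g" if "g \<in> G" for g
      using le[OF f(1) that] by (simp add: shunt1)
    ultimately show ?thesis using ne by (auto simp: least_ultracontact_def)
  qed
qed

text \<open>A lower bound \<open>x\<close> of \<open>F\<close> amounts to
  \<open>{x} \<preceq>\<^sub>s F\<close>, so K2 and K3 alone force \<open>F\<close> into
  \<open>K\<close>.\<close>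

lemma least_ultracontact_subset:
  fixes K :: "'a::boolean_algebra set set"
  assumes "ultracontact K"
  shows "least_ultracontact \<subseteq> K"
proof
  fix F :: "'a set" assume "F \<in> least_ultracontact"
  then obtain x :: 'a where "F \<noteq> {}" "x \<noteq> bot_class.bot" "{x} \<preceq>\<^sub>s F"
    by (auto simp: least_ultracontact_def set_prec_def)
  then show "F \<in> K"
    using ultracontact.K2[OF assms] ultracontact.K3[OF assms] by blast
qed

lemma carrier_UC: "carrier UC = {K. ultracontact K}"
  by (simp add: UC_def)

lemma partial_order_UC: "partial_order UC"
  by unfold_locales (auto simp: UC_def)

lemma least_UC_iff:
  "least UC L A \<longleftrightarrow> A \<subseteq> carrier UC \<and> L \<in> A \<and> (\<forall>K\<in>A. L \<subseteq> K)"
  by (auto simp: least_def UC_def)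

lemma Upper_UC:
  "\<A> \<subseteq> carrier UC \<Longrightarrow> Upper UC \<A> = {K. ultracontact K \<and> (\<forall>L\<in>\<A>. L \<subseteq> K)}"
  by (auto simp: Upper_def UC_def)

lemma Lower_UC:
  "\<A> \<subseteq> carrier UC \<Longrightarrow> Lower UC \<A> = {K. ultracontact K \<and> (\<forall>L\<in>\<A>. K \<subseteq> L)}"
  by (auto simp: Lower_def UC_def)

lemma least_Upper_UC_Union:
  assumes "\<A> \<subseteq> carrier UC" and "\<A> \<noteq> {}"
  shows "least UC (\<Union>\<A>) (Upper UC \<A>)"
  using assms ultracontact_Union[of \<A>]
  by (auto simp: least_UC_iff Upper_UC carrier_UC)

text \<open>Every ultracontact is an upper bound of the empty family, so its supremum is the least
  ultracontact.\<close>

lemma least_Upper_UC_empty: "least UC least_ultracontact (Upper UC {})"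
  using ultracontact_least_ultracontact least_ultracontact_subset
  by (auto simp: least_UC_iff Upper_UC carrier_UC)

text \<open>A union of lower bounds is still contained in each member of \<open>\<A>\<close>, and by
  \<open>ultracontact_Union\<close> it is an ultracontact.\<close>

lemma greatest_Lower_UC:
  assumes "\<A> \<subseteq> carrier UC"
  shows "greatest UC (\<Union>(Lower UC \<A>)) (Lower UC \<A>)"
proof -
  \<comment> \<open>Supplies the non-emptiness that \<open>ultracontact_Union\<close> asks of the
    family of lower bounds.\<close>
  have "least_ultracontact \<in> Lower UC \<A>"
    using assms ultracontact_least_ultracontact least_ultracontact_subset
    by (auto simp: Lower_UC carrier_UC)
  then have "ultracontact (\<Union>(Lower UC \<A>))"
    by (intro ultracontact_Union) (auto simp: Lower_UC assms)
  then have "\<Union>(Lower UC \<A>) \<in> Lower UC \<A>"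
    by (auto simp: Lower_UC assms)
  moreover have "K \<subseteq> \<Union>(Lower UC \<A>)" if "K \<in> Lower UC \<A>" for K
    using that by blast
  ultimately show ?thesis
    by (simp add: greatest_def) (simp add: UC_def)
qed

lemma complete_lattice_UC: "complete_lattice UC"
proof -
  interpret partial_order UC by (rule partial_order_UC)
  show ?thesis
  proof unfold_locales
    fix \<A> :: "'a set set set" assume \<A>: "\<A> \<subseteq> carrier UC"
    show "\<exists>s. least UC s (Upper UC \<A>)"
      using least_Upper_UC_empty least_Upper_UC_Union[OF \<A>] by (cases "\<A> = {}") auto
    show "\<exists>i. greatest UC i (Lower UC \<A>)"
      using greatest_Lower_UC[OF \<A>] by blast
  qed
qed

lemma join_UC:
  assumes "\<A> \<subseteq> carrier UC" and "\<A> \<noteq> {}"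
  shows "\<Squnion>\<^bsub>UC\<^esub> \<A> = \<Union>\<A>"
proof -
  have least: "least UC (\<Union>\<A>) (Upper UC \<A>)"
    using assms by (rule least_Upper_UC_Union)
  \<comment> \<open>The join is a Hilbert choice among least upper bounds. One exists, so the chosen
    set is one too, and two least elements include each other.\<close>
  then have "least UC (\<Squnion>\<^bsub>UC\<^esub> \<A>) (Upper UC \<A>)"
    unfolding Lattice.sup_def by (rule someI)
  with least show ?thesis
    by (intro subset_antisym) (simp_all add: least_UC_iff)
qed

theorem theorem4p7:
  assumes nontrivial: "(bot_class.bot :: 'a::boolean_algebra) \<noteq> top_class.top"
  shows "complete_lattice (UC :: 'a set set gorder) \<and>
    (\<forall>\<A>. \<A> \<subseteq> carrier (UC :: 'a set set gorder) \<and> \<A> \<noteq> {} \<longrightarrow>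
        \<Squnion>\<^bsub>UC\<^esub> \<A> = \<Union>\<A>)"
  by (simp add: complete_lattice_UC join_UC)

end
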